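(* Let $H$ be a real Hilbert space with scalar product $(\cdot,\cdot)_H$ and norm $|\cdot|_H$, and let $N\colon H\times H\to\mathbb{R}$ be a $C^1$ functional with partial gradients $N_u,N_v\colon H\times H\to H$. Assume: (h1) There are real numbers $\overline{\alpha},\underline{\alpha}$ with $0\le\overline{\alpha},\underline{\alpha}<\tfrac12$ and $\overline{\alpha}+\underline{\alpha}<\tfrac12$, and $C>0$, such that $$-\underline{\alpha}|v|_H^2-C\le N(u,v)\le\overline{\alpha}|u|_H^2+C\quad\text{for all }u,v\in H.$$ (h2) There are nonnegative real numbers $m_{ij}$ ($i,j\in\{1,2\}$) such that for all $u,v,\overline{u},\overline{v}\in H$, $$(N_u(u,v)-N_u(\overline{u},\overline{v}),u-\overline{u})_H\le m_{11}|u-\overline{u}|_H^2+m_{12}|u-\overline{u}|_H|v-\overline{v}|_H,$$ $$(N_v(u,v)-N_v(\overline{u},\overline{v}),v-\overline{v})_H\ge -m_{22}|v-\overline{v}|_H^2-m_{21}|u-\overline{u}|_H|v-\overline{v}|_H.$$ (h3) The matrix $M=(m_{ij})_{1\le i,j\le2}$ is convergent to zero. Then there exists a partial critical point $(u^\ast,v^\ast)\in H\times H$ for the pair of functionals $(E_1,E_2)$, where $E_1(u,v)=\tfrac12|u|_H^2-N(u,v)$ and $E_2(u,v)=-\tfrac12|v|_H^2-N(u,v)$.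
   Context: $N_u(u,v),N_v(u,v)\in H$ are the partial Fréchet derivatives of $N$ with respect to the first and second variable, identified with elements of $H$ via the Riesz representation theorem. A square matrix $M$ with nonnegative entries is called convergent to zero if $M^k\to0$ as $k\to\infty$ (equivalently, its spectral radius is less than $1$). Put $E_{11}(u,v)$ for the partial gradient of $E_1$ with respect to $u$, that is $E_{11}(u,v)=u-N_u(u,v)$, and $E_{22}(u,v)$ for the partial gradient of $E_2$ with respect to $v$, that is $E_{22}(u,v)=-v-N_v(u,v)$. A point $(u^\ast,v^\ast)$ is a partial critical point for $(E_1,E_2)$ if $E_{11}(u^\ast,v^\ast)=0$ and $E_{22}(u^\ast,v^\ast)=0$. *)

theory Defs
  imports "HOL-Analysis.Analysis"
begin

text \<open>A real Hilbert space is a type of sort \<open>{real_inner, complete_space}\<close>.\<close>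

definition C1_functional :: "('b::real_normed_vector \<Rightarrow> real) \<Rightarrow> bool" where
  "C1_functional F \<longleftrightarrow>
     (\<exists>F' :: 'b \<Rightarrow> ('b \<Rightarrow>\<^sub>L real).
        (\<forall>x. (F has_derivative blinfun_apply (F' x)) (at x)) \<and> continuous_on UNIV F')"

text \<open>\<open>GDERIV f x :> g\<close> says that \<open>f\<close> is Frechet differentiable at \<open>x\<close> with derivative
  \<open>\<lambda>h. h \<bullet> g\<close>, so \<open>g\<close> is the Riesz representative of the derivative.\<close>

definition has_partial_gradient_fst ::
    "('a::real_inner \<times> 'a \<Rightarrow> real) \<Rightarrow> 'a \<Rightarrow> 'a \<times> 'a \<Rightarrow> bool" where
  "has_partial_gradient_fst F g p \<longleftrightarrow> (GDERIV (\<lambda>x. F (x, snd p)) (fst p) :> g)"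

definition has_partial_gradient_snd ::
    "('a::real_inner \<times> 'a \<Rightarrow> real) \<Rightarrow> 'a \<Rightarrow> 'a \<times> 'a \<Rightarrow> bool" where
  "has_partial_gradient_snd F g p \<longleftrightarrow> (GDERIV (\<lambda>y. F (fst p, y)) (snd p) :> g)"

definition partial_critical_point ::
    "('a::real_inner \<times> 'a \<Rightarrow> real) \<Rightarrow> ('a \<times> 'a \<Rightarrow> real) \<Rightarrow> 'a \<times> 'a \<Rightarrow> bool" where
  "partial_critical_point F G p \<longleftrightarrow>
     has_partial_gradient_fst F 0 p \<and> has_partial_gradient_snd G 0 p"

definition E1 :: "('a::real_inner \<times> 'a \<Rightarrow> real) \<Rightarrow> 'a \<times> 'a \<Rightarrow> real" where
  "E1 N = (\<lambda>(u, v). (1/2) * (norm u)\<^sup>2 - N (u, v))"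

definition E2 :: "('a::real_inner \<times> 'a \<Rightarrow> real) \<Rightarrow> 'a \<times> 'a \<Rightarrow> real" where
  "E2 N = (\<lambda>(u, v). - (1/2) * (norm v)\<^sup>2 - N (u, v))"

text \<open>Multiplication (and hence \<open>^\<close>) is componentwise on the vector type, so the power of
  a matrix is defined here with the matrix product.\<close>

primrec matrix_power :: "real^'n^'n \<Rightarrow> nat \<Rightarrow> real^'n^'n" where
  "matrix_power A 0 = mat 1"
| "matrix_power A (Suc k) = A ** matrix_power A k"

definition convergent_to_zero :: "real^'n^'n \<Rightarrow> bool" where
  "convergent_to_zero A \<longleftrightarrow> matrix_power A \<longlonglongrightarrow> 0"

end

theory Submission
  imports Defs
begin

text \<open>For fixed \<open>v\<close> the functional \<open>E\<^sub>1(\<cdot>, v)\<close> is strongly convex with modulus \<open>1 - m\<^sub>1\<^sub>1\<close>, and for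
  fixed \<open>u\<close> so is \<open>- E\<^sub>2(u, \<cdot>)\<close> with modulus \<open>1 - m\<^sub>2\<^sub>2\<close>; hence both have critical points \<open>A v\<close> and
  \<open>B u\<close>. By (h2), \<open>A\<close> and \<open>B\<close> are Lipschitz with constants \<open>m\<^sub>1\<^sub>2 / (1 - m\<^sub>1\<^sub>1)\<close> and
  \<open>m\<^sub>2\<^sub>1 / (1 - m\<^sub>2\<^sub>2)\<close>, whose product is less than 1 because \<open>M\<close> is convergent to zero. The
  fixed point \<open>u\<close> of the contraction \<open>A \<circ> B\<close> gives the partial critical point \<open>(u, B u)\<close>.\<close>

text \<open>A nonnegative matrix preserves the componentwise order, so \<open>x \<le> A x\<close>
  iterates to \<open>x \<le> A^k x\<close>, and the right side tends to 0. The entries of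
  \<open>x\<close> may have any sign. This extracts inequalities from (h3) without
  eigenvalues.\<close>

lemma convergent_to_zero_subinvariant_vector:
  fixes A :: "real^'n^'n" and x :: "real^'n"
  assumes conv: "convergent_to_zero A"
    and A_nonneg: "\<And>i j. 0 \<le> A $ i $ j"
    and sub: "\<forall>i. x $ i \<le> (A *v x) $ i"
  shows "x $ i \<le> 0"
proof -
  have mono: "(A *v y) $ i \<le> (A *v z) $ i" if "\<And>j. y $ j \<le> z $ j" for y z i
    unfolding matrix_vector_mult_def vec_lambda_beta
    using that A_nonneg by (auto intro!: sum_mono mult_left_mono)
  have power: "x $ i \<le> (matrix_power A k *v x) $ i" for k i
  proof (induction k arbitrary: i)
    case 0
    then show ?case by simp
  next
    case (Suc k)
    have "x $ i \<le> (A *v x) $ i" using sub by simp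
    also have "\<dots> \<le> (A *v (matrix_power A k *v x)) $ i" by (rule mono) (rule Suc)
    finally show ?case by (simp add: matrix_vector_mul_assoc)
  qed
  have "(\<lambda>k. \<Sum>j\<in>UNIV. matrix_power A k $ i $ j * x $ j) \<longlonglongrightarrow> (\<Sum>j\<in>UNIV. 0 $ i $ j * x $ j)"
    using conv unfolding convergent_to_zero_def by (intro tendsto_intros)
  then have "(\<lambda>k. (matrix_power A k *v x) $ i) \<longlonglongrightarrow> 0"
    by (simp add: matrix_vector_mult_def)
  then show ?thesis
    using power by (intro LIMSEQ_le_const) auto
qed

text \<open>If one of the inequalities failed, an explicit subinvariant vector with a positive entry
  would exist: a unit vector in the two diagonal cases.\<close>

lemma convergent_to_zero_2x2:
  fixes M :: "real^2^2"
  assumes conv: "convergent_to_zero M" and nonneg: "\<And>i j. 0 \<le> M $ i $ j"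
  shows "M $ 1 $ 1 < 1" "M $ 2 $ 2 < 1"
    "M $ 1 $ 2 * M $ 2 $ 1 < (1 - M $ 1 $ 1) * (1 - M $ 2 $ 2)"
proof -
  note sub = convergent_to_zero_subinvariant_vector[OF conv nonneg]
  show m11: "M $ 1 $ 1 < 1"
  proof (rule ccontr)
    assume "\<not> ?thesis"
    then have "(vector [1, 0] :: real^2) $ 1 \<le> 0"
      using nonneg by (intro sub) (simp add: forall_2 matrix_vector_mult_def sum_2)
    then show False by simp
  qed
  show "M $ 2 $ 2 < 1"
  proof (rule ccontr)
    assume "\<not> ?thesis"
    then have "(vector [0, 1] :: real^2) $ 2 \<le> 0"
      using nonneg by (intro sub) (simp add: forall_2 matrix_vector_mult_def sum_2)
    then show False by simp
  qed
  show "M $ 1 $ 2 * M $ 2 $ 1 < (1 - M $ 1 $ 1) * (1 - M $ 2 $ 2)"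
  proof (rule ccontr)
    assume "\<not> ?thesis"
    \<comment> \<open>This vector is chosen so that \<open>M\<close> fixes its first entry; for the
      second entry, subinvariance is exactly the negated product inequality.\<close>
    then have "(vector [M $ 1 $ 2, 1 - M $ 1 $ 1] :: real^2) $ 2 \<le> 0"
      by (intro sub) (simp add: forall_2 matrix_vector_mult_def sum_2 algebra_simps)
    then show False using m11 by simp
  qed
qed

text \<open>Along the segment from \<open>x\<close> to \<open>y\<close>, \<open>f\<close> minus its
  linear part at \<open>x\<close> and the quadratic term has derivative \<open>\<phi>'\<close>,
  which monotonicity makes nonnegative; compare the values at 0 and 1.\<close>

lemma strongly_monotone_gradient_lower_bound:
  fixes f :: "'a::real_inner \<Rightarrow> real"
  assumes grad: "\<And>x. GDERIV f x :> g x"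
    and mono: "\<And>x y. (g x - g y) \<bullet> (x - y) \<ge> c * (norm (x - y))\<^sup>2"
  shows "f y \<ge> f x + g x \<bullet> (y - x) + c / 2 * (norm (y - x))\<^sup>2"
proof -
  define h where "h = y - x"
  define \<phi> where "\<phi> t = f (x + t *\<^sub>R h) - t * (g x \<bullet> h) - c / 2 * t\<^sup>2 * (norm h)\<^sup>2" for t
  define \<phi>' where "\<phi>' t = (g (x + t *\<^sub>R h) - g x) \<bullet> h - c * t * (norm h)\<^sup>2" for t
  have "((\<lambda>t. f (x + t *\<^sub>R h)) has_derivative (\<lambda>s. (s *\<^sub>R h) \<bullet> g (x + t *\<^sub>R h))) (at t)" for t
  proof (rule has_derivative_compose[of "\<lambda>t. x + t *\<^sub>R h"])
    show "((\<lambda>t. x + t *\<^sub>R h) has_derivative (\<lambda>s. s *\<^sub>R h)) (at t)"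
      by (auto intro!: derivative_eq_intros)
  qed (use grad in \<open>simp add: gderiv_def\<close>)
  then have "((\<lambda>t. f (x + t *\<^sub>R h)) has_real_derivative g (x + t *\<^sub>R h) \<bullet> h) (at t)" for t
    by (simp add: has_field_derivative_def inner_commute mult_commute_abs)
  then have deriv: "(\<phi> has_real_derivative \<phi>' t) (at t)" for t
    unfolding \<phi>_def \<phi>'_def
    by (auto intro!: derivative_eq_intros simp: inner_diff_left)
  have "\<phi>' t \<ge> 0" if "t \<ge> 0" for t
  proof (cases "t = 0")
    case False
    \<comment> \<open>The factor \<open>t\<close> turns \<open>h\<close> into the increment
      \<open>t h\<close> of the argument, which is what \<open>mono\<close> needs.\<close>
    have "t * \<phi>' t = (g (x + t *\<^sub>R h) - g x) \<bullet> ((x + t *\<^sub>R h) - x)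
        - c * (norm ((x + t *\<^sub>R h) - x))\<^sup>2"
      by (simp add: \<phi>'_def algebra_simps power2_eq_square)
    also have "\<dots> \<ge> 0" using mono[of "x + t *\<^sub>R h" x] by linarith
    finally show ?thesis using that False by (simp add: zero_le_mult_iff)
  qed (simp add: \<phi>'_def)
  then have "\<phi> 0 \<le> \<phi> 1"
    using deriv by (intro DERIV_nonneg_imp_nondecreasing[of 0 1 \<phi>]) auto
  then show ?thesis by (simp add: \<phi>_def h_def)
qed

text \<open>Direct minimization: strong convexity bounds \<open>f\<close> below and makes a
  minimizing sequence Cauchy, so completeness replaces compactness. The gradient vanishes at the
  minimizer.\<close>

lemma strongly_monotone_gradient_zero:
  fixes f :: "'a::{real_inner, complete_space} \<Rightarrow> real"
  assumes grad: "\<And>x. GDERIV f x :> g x"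
    and "c > 0"
    and mono: "\<And>x y. (g x - g y) \<bullet> (x - y) \<ge> c * (norm (x - y))\<^sup>2"
  shows "\<exists>x. g x = 0"
proof -
  note lower = strongly_monotone_gradient_lower_bound[OF grad mono]
  define m where "m = Inf (range f)"
  \<comment> \<open>Completing the square in \<open>norm y\<close> gives the minimum of the
    quadratic lower bound based at 0.\<close>
  have "f y \<ge> f 0 - (norm (g 0))\<^sup>2 / (2 * c)" for y
  proof -
    have "g 0 \<bullet> y \<ge> - (norm (g 0) * norm y)"
      using Cauchy_Schwarz_ineq2[of "g 0" y] by linarith
    moreover have "c / 2 * (norm y)\<^sup>2 - norm (g 0) * norm y + (norm (g 0))\<^sup>2 / (2 * c)
        = (c * norm y - norm (g 0))\<^sup>2 / (2 * c)"
      using \<open>c > 0\<close> by (simp add: field_simps power2_eq_square)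
    moreover have "\<dots> \<ge> 0" using \<open>c > 0\<close> by simp
    ultimately show ?thesis using lower[of 0 y] by simp
  qed
  then have bdd: "bdd_below (range f)" by (intro bdd_belowI2)
  then have m_le: "m \<le> f x" for x unfolding m_def by (intro cInf_lower) auto
  have near: "\<exists>x. f x < m + e" if "e > 0" for e
    using cInf_lessD[of "range f" "m + e"] that by (auto simp: m_def)
  have close: "(norm (x - y))\<^sup>2 \<le> 4 / c * ((f x - m) + (f y - m))" for x y
  proof -
    define z where "z = (1/2) *\<^sub>R (x + y)"
    have xz: "x - z = (1/2) *\<^sub>R (x - y)" and yz: "y - z = - (1/2) *\<^sub>R (x - y)"
      by (simp_all add: z_def algebra_simps flip: scaleR_add_left)
    \<comment> \<open>In the sum of the two bounds based at the midpoint \<open>z\<close> the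
      gradient terms cancel, as \<open>x - z\<close> and \<open>y - z\<close> are opposite; each
      quadratic term contributes \<open>c / 8\<close>.\<close>
    have "f x + f y \<ge> 2 * f z + c / 4 * (norm (x - y))\<^sup>2"
      using lower[of z x] lower[of z y] unfolding xz yz by (simp add: power2_eq_square)
    then have "c / 4 * (norm (x - y))\<^sup>2 \<le> (f x - m) + (f y - m)"
      using m_le[of z] by linarith
    then show ?thesis using \<open>c > 0\<close> by (simp add: field_simps)
  qed
  have "\<exists>X. \<forall>n. f (X n) < m + inverse (real (Suc n))"
    by (intro choice allI near) simp
  then obtain X where X: "\<And>n. f (X n) < m + inverse (real (Suc n))" by blast
  have "(\<lambda>n. m + inverse (real (Suc n))) \<longlonglongrightarrow> m + 0"
    by (intro tendsto_intros LIMSEQ_inverse_real_of_nat)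
  then have fX: "(\<lambda>n. f (X n)) \<longlonglongrightarrow> m"
    using X m_le by (intro tendsto_sandwich[of "\<lambda>_. m" "\<lambda>n. f (X n)"])
      (auto intro!: always_eventually less_imp_le)
  have "Cauchy X"
  proof (rule metric_CauchyI)
    fix e :: real assume "e > 0"
    \<comment> \<open>Two excesses over \<open>m\<close> below this value sum to less than
      \<open>c * e^2 / 4\<close>, which \<open>close\<close> turns into a squared distance below
      \<open>e^2\<close>.\<close>
    then have "c * e\<^sup>2 / 8 > 0" using \<open>c > 0\<close> by simp
    then have "eventually (\<lambda>n. f (X n) < m + c * e\<^sup>2 / 8) sequentially"
      using fX by (intro order_tendstoD(2)) auto
    then obtain K where K: "\<And>n. n \<ge> K \<Longrightarrow> f (X n) < m + c * e\<^sup>2 / 8"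
      by (auto simp: eventually_sequentially)
    have "dist (X i) (X j) < e" if "i \<ge> K" "j \<ge> K" for i j
    proof -
      have "(f (X i) - m) + (f (X j) - m) < c * e\<^sup>2 / 4"
        using K[OF that(1)] K[OF that(2)] by (simp add: field_simps)
      then have "4 / c * ((f (X i) - m) + (f (X j) - m)) < e\<^sup>2"
        using \<open>c > 0\<close> by (simp add: field_simps)
      then have "(dist (X i) (X j))\<^sup>2 < e\<^sup>2"
        using close[of "X i" "X j"] by (simp add: dist_norm)
      then show ?thesis using \<open>e > 0\<close> by (meson less_imp_le power2_less_imp_less)
    qed
    then show "\<exists>K. \<forall>i\<ge>K. \<forall>j\<ge>K. dist (X i) (X j) < e" by blast
  qed
  then obtain x where x: "X \<longlonglongrightarrow> x" using Cauchy_convergent convergent_def by blast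
  have "isCont f x" using grad[of x] unfolding gderiv_def by (rule has_derivative_continuous)
  then have "(\<lambda>n. f (X n)) \<longlonglongrightarrow> f x" using x by (rule isCont_tendsto_compose)
  then have "f x = m" using fX LIMSEQ_unique by blast
  then have "(\<lambda>h. h \<bullet> g x) = (\<lambda>h. 0)"
    using grad[of x] m_le unfolding gderiv_def
    by (intro has_derivative_local_min[of f _ x]) auto
  then have "g x \<bullet> g x = 0" by metis
  then show ?thesis by auto
qed

lemma GDERIV_half_norm_power2: "GDERIV (\<lambda>x. (1/2) * (norm x)\<^sup>2) x :> x"
  unfolding gderiv_def power2_norm_eq_inner
  by (auto intro!: derivative_eq_intros simp: inner_commute)

text \<open>Meant for \<open>r\<close> the distance between two critical points and \<open>s\<close>
  that between their parameters; a factor \<open>r\<close> cancels unless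
  \<open>r = 0\<close>.\<close>

lemma lipschitz_from_quadratic_bound:
  fixes m l r s :: real
  assumes "r\<^sup>2 \<le> m * r\<^sup>2 + l * r * s" "m < 1" "0 \<le> l" "0 \<le> r" "0 \<le> s"
  shows "r \<le> l / (1 - m) * s"
proof (cases "r = 0")
  case False
  have "r * ((1 - m) * r) \<le> r * (l * s)"
    using assms(1) by (simp add: algebra_simps power2_eq_square)
  then have "(1 - m) * r \<le> l * s" using False \<open>0 \<le> r\<close> by simp
  then show ?thesis using \<open>m < 1\<close> by (simp add: field_simps)
qed (use assms in simp)

theorem theorem2p3:
  fixes N :: "'a::{real_inner, complete_space} \<times> 'a \<Rightarrow> real"
    and Nu Nv :: "'a \<times> 'a \<Rightarrow> 'a"
    and \<alpha>_upper \<alpha>_lower C :: real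
    and M :: "real^2^2"
  assumes C1: "C1_functional N"
    and Nu: "\<And>p. has_partial_gradient_fst N (Nu p) p"
    and Nv: "\<And>p. has_partial_gradient_snd N (Nv p) p"
    and h1_const: "0 \<le> \<alpha>_upper" "\<alpha>_upper < 1/2" "0 \<le> \<alpha>_lower" "\<alpha>_lower < 1/2"
      "\<alpha>_upper + \<alpha>_lower < 1/2" "0 < C"
    and h1_lower: "\<And>u v. - \<alpha>_lower * (norm v)\<^sup>2 - C \<le> N (u, v)"
    and h1_upper: "\<And>u v. N (u, v) \<le> \<alpha>_upper * (norm u)\<^sup>2 + C"
    and h2_nonneg: "\<And>i j. 0 \<le> M $ i $ j"
    and h2_u: "\<And>u v u' v'. (Nu (u, v) - Nu (u', v')) \<bullet> (u - u')
        \<le> M $ 1 $ 1 * (norm (u - u'))\<^sup>2 + M $ 1 $ 2 * norm (u - u') * norm (v - v')"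
    and h2_v: "\<And>u v u' v'. (Nv (u, v) - Nv (u', v')) \<bullet> (v - v')
        \<ge> - M $ 2 $ 2 * (norm (v - v'))\<^sup>2 - M $ 2 $ 1 * norm (u - u') * norm (v - v')"
    and h3: "convergent_to_zero M"
  shows "\<exists>p. partial_critical_point (E1 N) (E2 N) p"
proof -
  note m = convergent_to_zero_2x2[OF h3 h2_nonneg]
  have grad_u: "GDERIV (\<lambda>x. E1 N (x, v)) u :> u - Nu (u, v)" for u v
    using GDERIV_diff[OF GDERIV_half_norm_power2 Nu[of "(u, v)", unfolded has_partial_gradient_fst_def]]
    by (simp add: E1_def)
  have grad_v: "GDERIV (\<lambda>y. - E2 N (u, y)) v :> v + Nv (u, v)" for u v
    using GDERIV_add[OF GDERIV_half_norm_power2 Nv[of "(u, v)", unfolded has_partial_gradient_snd_def]]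
    by (simp add: E2_def add.commute)
  have "\<exists>u. u - Nu (u, v) = 0" for v
  proof (rule strongly_monotone_gradient_zero[OF grad_u])
    show "1 - M $ 1 $ 1 > 0" using m by simp
    show "(x - Nu (x, v) - (y - Nu (y, v))) \<bullet> (x - y) \<ge> (1 - M $ 1 $ 1) * (norm (x - y))\<^sup>2" for x y
      using h2_u[of x v y v]
      by (simp add: power2_norm_eq_inner algebra_simps)
  qed
  then obtain A where A: "\<And>v. Nu (A v, v) = A v" by (metis right_minus_eq)
  have "\<exists>v. v + Nv (u, v) = 0" for u
  proof (rule strongly_monotone_gradient_zero[OF grad_v])
    show "1 - M $ 2 $ 2 > 0" using m by simp
    show "(x + Nv (u, x) - (y + Nv (u, y))) \<bullet> (x - y) \<ge> (1 - M $ 2 $ 2) * (norm (x - y))\<^sup>2" for x y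
      using h2_v[where u=u and v=x and u'=u and v'=y]
      by (simp add: power2_norm_eq_inner algebra_simps)
  qed
  then obtain B where B: "\<And>u. Nv (u, B u) = - B u" by (metis add_eq_0_iff)
  define a where "a = M $ 1 $ 2 / (1 - M $ 1 $ 1)"
  define b where "b = M $ 2 $ 1 / (1 - M $ 2 $ 2)"
  \<comment> \<open>Since \<open>Nu (A v, v) = A v\<close>, the left side of (h2) at these points is
    the squared distance of \<open>A v\<close> and \<open>A v'\<close>.\<close>
  have A_lip: "norm (A v - A v') \<le> a * norm (v - v')" for v v'
    unfolding a_def using h2_u[of "A v" v "A v'" v'] m h2_nonneg
    by (intro lipschitz_from_quadratic_bound) (auto simp: A power2_norm_eq_inner)
  have B_lip: "norm (B u - B u') \<le> b * norm (u - u')" for u u'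
  proof -
    have "(- B u + B u') \<bullet> (B u - B u') = - (norm (B u - B u'))\<^sup>2"
      by (simp add: power2_norm_eq_inner algebra_simps)
    then show ?thesis
      unfolding b_def using h2_v[where u=u and v="B u" and u'=u' and v'="B u'"] m h2_nonneg
      by (intro lipschitz_from_quadratic_bound) (auto simp: B mult.commute mult.left_commute)
  qed
  have "0 \<le> a" "0 \<le> b" using m h2_nonneg by (simp_all add: a_def b_def)
  \<comment> \<open>This is the product inequality for \<open>M\<close> divided by its positive
    right side.\<close>
  have "a * b < 1" using m by (simp add: a_def b_def)
  have "dist (A (B u)) (A (B u')) \<le> (a * b) * dist u u'" for u u'
    using A_lip[of "B u" "B u'"] mult_left_mono[OF B_lip[of u u'] \<open>0 \<le> a\<close>]
    by (simp add: dist_norm)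
  then have "\<exists>!u. A (B u) = u"
    using \<open>0 \<le> a\<close> \<open>0 \<le> b\<close> \<open>a * b < 1\<close> by (intro banach_fix_type[of "a * b"]) auto
  then obtain u where u: "A (B u) = u" by blast
  have "GDERIV (\<lambda>x. E1 N (x, B u)) u :> 0"
    using grad_u[of "B u" u] A[of "B u"] by (simp add: u)
  moreover have "GDERIV (\<lambda>y. E2 N (u, y)) (B u) :> 0"
    using GDERIV_minus[OF grad_v[of u "B u"]] by (simp add: B)
  ultimately have "partial_critical_point (E1 N) (E2 N) (u, B u)"
    by (simp add: partial_critical_point_def has_partial_gradient_fst_def has_partial_gradient_snd_def)
  then show ?thesis ..
qed

end
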